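(* For each integer $n\ge 1$ let $$c_n=\frac{\Gamma(\frac n2)}{(2\pi)^{\frac n2}}\left[\int_0^{\infty}x^{\frac n2-1}\frac{\exp(-x)}{(1+\exp(-x))^2}\,dx\right]^{-1}.$$ Then: (i) If $n=1$, then $c_1=\frac{1}{\sqrt{2\pi}}\left(\Phi^*_{2}\left(-1,\frac12,1\right)\right)^{-1}$, where $\Phi^*_\mu$ is the generalized Hurwitz-Lerch Zeta function. (ii) If $n=2$, then $c_2=\pi^{-1}$. (iii) If $n=4$, then $c_4=\frac{1}{4\pi^2\ln 2}$. (iv) If $n\ge 3$ and $n\ne 4$, then $$c_n=\pi^{-\frac n2}\left[\left(2^{\frac n2}-4\right)\zeta\left(\frac n2-1\right)\right]^{-1},$$ where $\zeta$ is the Riemann zeta function.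
   Context: The constant $c_n$ is the normalizing constant of the $n$-dimensional elliptically symmetric logistic density $f(\mathbf x)=c_n|\mathbf\Sigma|^{-1/2}\frac{\exp(-\frac12 q(\mathbf x))}{(1+\exp(-\frac12 q(\mathbf x)))^2}$, with $q(\mathbf x)=(\mathbf x-\boldsymbol\mu)^T\mathbf\Sigma^{-1}(\mathbf x-\boldsymbol\mu)$. The generalized Hurwitz-Lerch Zeta function is $$\Phi^*_{\mu}(z,s,\alpha)=\frac{1}{\Gamma(\mu)}\sum_{k=0}^{\infty}\frac{\Gamma(\mu+k)}{k!}\frac{z^k}{(k+\alpha)^s},$$ with the integral representation $$\Phi^*_{\mu}(z,s,\alpha)=\frac{1}{\Gamma(s)}\int_0^{\infty}\frac{t^{s-1}e^{-\alpha t}}{(1-ze^{-t})^{\mu}}\,dt,$$ where $\mathrm{Re}(\alpha)>0$, and $\mathrm{Re}(s)>0$ when $|z|\le 1$, $z\ne 1$ ($\mathrm{Re}(s)>1$ when $z=1$). When the series does not converge (as can happen at $z=-1$), $\Phi^*_\mu$ is understood through the integral representation. The Riemann zeta function is $\zeta(s)=\sum_{k\ge1}k^{-s}$ for $\mathrm{Re}(s)>1$ and $\zeta(s)=\frac{1}{1-2^{1-s}}\sum_{k\ge1}\frac{(-1)^{k+1}}{k^s}$ for $\mathrm{Re}(s)>0$, $s\neq1$. *)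

theory Defs
  imports "HOL-Analysis.Analysis"
begin

text \<open>
  The normalizing constant \<open>c\<^sub>n\<close> of the elliptically symmetric logistic density on
  \<open>\<real>\<^sup>n\<close>, proportional to \<open>exp (- q/2) / (1 + exp (- q/2))\<^sup>2\<close> for the quadratic form
  \<open>q = (x - \<mu>)\<^sup>T \<Sigma>\<^sup>-\<^sup>1 (x - \<mu>)\<close>. The one-dimensional integral results from passing to
  polar coordinates and substituting \<open>q/2\<close>.
\<close>

definition logistic_const :: "nat \<Rightarrow> real" where
  "logistic_const n =
     Gamma (real n / 2) / (2 * pi) powr (real n / 2) *
     inverse (LBINT x:{0<..}. x powr (real n / 2 - 1) * (exp (- x) / (1 + exp (- x))\<^sup>2))"

text \<open>
  The generalized Hurwitz--Lerch zeta function, for \<open>Re \<alpha> > 0\<close> and \<open>\<mu>\<close> not a pole of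
  \<open>Gamma\<close>. It is given by its defining series where that series converges, and by the
  integral representation otherwise; powers are principal values. The divergent case does
  occur: at \<open>\<mu> = 2, z = -1, s = 1/2, \<alpha> = 1\<close> the terms are \<open>(-1)\<^sup>k (k+1)\<^sup>1\<^sup>/\<^sup>2\<close>.
\<close>

definition hurwitz_lerch_term ::
    "complex \<Rightarrow> complex \<Rightarrow> complex \<Rightarrow> complex \<Rightarrow> nat \<Rightarrow> complex" where
  "hurwitz_lerch_term \<mu> z s \<alpha> k =
     Gamma (\<mu> + of_nat k) / fact k * (z ^ k / (of_nat k + \<alpha>) powr s)"

definition hurwitz_lerch_zeta ::
    "complex \<Rightarrow> complex \<Rightarrow> complex \<Rightarrow> complex \<Rightarrow> complex" where
  "hurwitz_lerch_zeta \<mu> z s \<alpha> =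
     (if summable (hurwitz_lerch_term \<mu> z s \<alpha>)
      then 1 / Gamma \<mu> * (\<Sum>k. hurwitz_lerch_term \<mu> z s \<alpha> k)
      else 1 / Gamma s *
        (LBINT t:{0<..}. complex_of_real t powr (s - 1) * exp (- \<alpha> * complex_of_real t) /
                         (1 - z * exp (- complex_of_real t)) powr \<mu>))"

text \<open>
  The Riemann zeta function on \<open>Re s > 0\<close>, \<open>s \<noteq> 1\<close>. The second formula also has removable
  singularities at the points \<open>s \<noteq> 1\<close> with \<open>2 powr (1 - s) = 1\<close>; these all lie off the real
  axis, on the line \<open>Re s = 1\<close>, and the value \<open>0\<close> taken there has no meaning. The sums are
  indexed from \<open>0\<close>, hence the shift by \<open>Suc\<close>.
\<close>

definition riemann_zeta :: "complex \<Rightarrow> complex" where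
  "riemann_zeta s =
     (if Re s > 1 then (\<Sum>k. 1 / of_nat (Suc k) powr s)
      else 1 / (1 - 2 powr (1 - s)) * (\<Sum>k. (-1) ^ k / of_nat (Suc k) powr s))"

end

theory Submission
  imports Defs "HOL-Real_Asymp.Real_Asymp"
begin

text \<open>
  Put \<open>s = n/2\<close>. The logistic kernel is the derivative of \<open>- 1 / (1 + exp x)\<close>, so for \<open>s > 1\<close>
  integration by parts turns the normalizing integral into \<open>(s - 1) \<integral> x powr (s - 2) / (1 + exp x) dx\<close>.
  Expanding \<open>1 / (1 + exp x)\<close> as an alternating geometric series gives
  \<open>\<Gamma>(s) \<Sum>\<^sub>k (-1)\<^sup>k / (k + 1) powr (s - 1)\<close>; this covers \<open>n = 3\<close> too, where the series converges
  only conditionally. The series equals \<open>ln 2\<close> for \<open>s = 2\<close>, and otherwise is a multiple of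
  \<open>\<zeta>(s - 1)\<close>. For \<open>n = 1\<close> the Hurwitz--Lerch series diverges, so its integral representation applies
  and coincides with the normalizing integral.
\<close>

section \<open>Gamma integrals\<close>

text \<open>Euler's integral under the substitution \<open>u = a * t\<close>. The form
  \<open>has_bochner_integral\<close> delivers integrability and value together, as termwise
  integration requires.\<close>

lemma has_bochner_integral_Gamma_scaled:
  fixes s a :: real
  assumes s: "s > 0" and a: "a > 0"
  shows "has_bochner_integral lborel
           (\<lambda>t. indicator {0<..} t *\<^sub>R (t powr (s - 1) * exp (- (a * t)))) (Gamma s / a powr s)"
proof -
  have G: "has_bochner_integral lborel
             (\<lambda>t. indicator {0<..} t *\<^sub>R (t powr (s - 1) * exp (- t))) (Gamma s)"
  proof (rule has_bochner_integral_nn_integral)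
    have "(\<integral>\<^sup>+ t. ennreal (indicator {0<..} t *\<^sub>R (t powr (s - 1) * exp (- t))) \<partial>lborel) =
          (\<integral>\<^sup>+ t. ennreal (indicator {0..} t * t powr (s - 1) / exp t) \<partial>lborel)"
      by (intro nn_integral_cong) (auto simp: indicator_def exp_minus field_simps)
    then show "(\<integral>\<^sup>+ t. ennreal (indicator {0<..} t *\<^sub>R (t powr (s - 1) * exp (- t))) \<partial>lborel) =
               ennreal (Gamma s)"
      using Gamma_conv_nn_integral_real[OF s] by simp
  qed (use s in \<open>auto simp: Gamma_real_pos less_imp_le\<close>)
  have "has_bochner_integral lborel
          (\<lambda>t. indicator {0<..} (0 + a * t) *\<^sub>R ((0 + a * t) powr (s - 1) * exp (- (0 + a * t))))
          (Gamma s /\<^sub>R \<bar>a\<bar>)"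
    by (subst lborel_has_bochner_integral_real_affine_iff[symmetric]) (use a G in auto)
  \<comment> \<open>The factor \<open>1 / a powr (s - 1)\<close> cancels the one that splits off
    from \<open>(a * t) powr (s - 1)\<close>.\<close>
  then have "has_bochner_integral lborel
          (\<lambda>t. (1 / a powr (s - 1)) * (indicator {0<..} (0 + a * t) *\<^sub>R ((0 + a * t) powr (s - 1) * exp (- (0 + a * t)))))
          ((1 / a powr (s - 1)) * (Gamma s /\<^sub>R \<bar>a\<bar>))"
    by (rule has_bochner_integral_mult_right)
  also have "(1 / a powr (s - 1)) * (Gamma s /\<^sub>R \<bar>a\<bar>) = Gamma s / a powr s"
    using a by (simp add: powr_diff field_simps)
  also have "(\<lambda>t. (1 / a powr (s - 1)) * (indicator {0<..} (0 + a * t) *\<^sub>R ((0 + a * t) powr (s - 1) * exp (- (0 + a * t)))))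
      = (\<lambda>t. indicator {0<..} t *\<^sub>R (t powr (s - 1) * exp (- (a * t))))"
    using a by (auto simp: fun_eq_iff indicator_def powr_mult zero_less_mult_iff)
  finally show ?thesis .
qed

lemma set_integrable_Gamma:
  "s > 0 \<Longrightarrow> set_integrable lborel {0<..} (\<lambda>t::real. t powr (s - 1) * exp (- t))"
  using has_bochner_integral_Gamma_scaled[of s 1]
  by (auto simp: set_integrable_def has_bochner_integral_iff)

section \<open>Mellin transform of the Fermi kernel and the alternating series\<close>

text \<open>A finite geometric sum with ratio \<open>- exp (- x)\<close>, which is never 1. The
  closed form splits each partial sum into the limit \<open>1 / (1 + exp x)\<close> and an explicit
  error factor.\<close>

lemma alternating_exp_sum:
  fixes x :: real
  shows "(\<Sum>k<N. (-1) ^ k * exp (- (real (Suc k) * x))) = (1 - (- exp (- x)) ^ N) / (1 + exp x)"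
proof -
  have "(\<Sum>k<N. (-1) ^ k * exp (- (real (Suc k) * x))) = exp (- x) * (\<Sum>k<N. (- exp (- x)) ^ k)"
    unfolding sum_distrib_left
  proof (rule sum.cong[OF refl])
    fix k
    have "exp (- (real (Suc k) * x)) = exp (- x) ^ Suc k"
      by (subst exp_of_nat_mult[symmetric]) simp
    then show "(-1) ^ k * exp (- (real (Suc k) * x)) = exp (- x) * (- exp (- x)) ^ k"
      by (simp add: power_minus[of "exp (- x)"])
  qed
  also have "(\<Sum>k<N. (- exp (- x)) ^ k) = (1 - (- exp (- x)) ^ N) / (1 + exp (- x))"
    using sum_gp_strict[of "- exp (- x)" N] exp_gt_zero[of "- x"] by (auto simp: less_le)
  also have "exp (- x) * \<dots> = (1 - (- exp (- x)) ^ N) / (1 + exp x)"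
    by (simp add: exp_minus divide_simps)
  finally show ?thesis .
qed

text \<open>Integral formula for the Dirichlet eta function: the closed form of the partial sums is
  integrated against \<open>x powr (\<sigma> - 1)\<close>, and dominated convergence gives the
  limit.\<close>

lemma eta_sums:
  fixes \<sigma> :: real
  assumes \<sigma>: "\<sigma> > 0"
  shows "(\<lambda>k. (-1) ^ k / real (Suc k) powr \<sigma>) sums
           ((LBINT x:{0<..}. x powr (\<sigma> - 1) / (1 + exp x)) / Gamma \<sigma>)"
proof -
  define g where "g k x = indicator {0<..} x *\<^sub>R (x powr (\<sigma> - 1) * exp (- (real (Suc k) * x)))" for k x
  define f where "f x = indicator {0<..} x *\<^sub>R (x powr (\<sigma> - 1) / (1 + exp x))" for x :: real
  have g: "has_bochner_integral lborel (g k) (Gamma \<sigma> / real (Suc k) powr \<sigma>)" for k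
    unfolding g_def by (rule has_bochner_integral_Gamma_scaled) (use \<sigma> in auto)
  have sg: "(\<Sum>k<N. (-1) ^ k * g k x) = f x * (1 - (- exp (- x)) ^ N)" for N x
  proof -
    have "(\<Sum>k<N. (-1) ^ k * g k x) = indicator {0<..} x * x powr (\<sigma> - 1) *
            (\<Sum>k<N. (-1) ^ k * exp (- (real (Suc k) * x)))"
      unfolding g_def sum_distrib_left by (rule sum.cong) auto
    then show ?thesis
      unfolding alternating_exp_sum f_def by simp
  qed
  \<comment> \<open>Dominating the partial sums, rather than the sum of the absolute values of the terms,
     reaches all \<open>\<sigma> > 0\<close> and not only \<open>\<sigma> > 1\<close>.\<close>
  have "(\<lambda>N. integral\<^sup>L lborel (\<lambda>x. \<Sum>k<N. (-1) ^ k * g k x)) \<longlonglongrightarrow> integral\<^sup>L lborel f"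
  proof (rule integral_dominated_convergence)
    show "f \<in> borel_measurable lborel" unfolding f_def by measurable
    show "(\<lambda>x. \<Sum>k<N. (-1) ^ k * g k x) \<in> borel_measurable lborel" for N
      unfolding g_def by measurable
    show "integrable lborel (\<lambda>x. 2 * g 0 x)"
      using g[of 0] by (auto simp: has_bochner_integral_iff)
    have "(\<lambda>N. f x * (1 - (- exp (- x)) ^ N)) \<longlonglongrightarrow> f x" for x
    proof (cases "x > 0")
      case True
      then have "(\<lambda>N. f x * (1 - (- exp (- x)) ^ N)) \<longlonglongrightarrow> f x * (1 - 0)"
        by (intro tendsto_intros LIMSEQ_power_zero) auto
      then show ?thesis by simp
    qed (simp add: f_def)
    then show "AE x in lborel. (\<lambda>N. \<Sum>k<N. (-1) ^ k * g k x) \<longlonglongrightarrow> f x"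
      unfolding sg by simp
    \<comment> \<open>For \<open>x > 0\<close> the ratio has modulus below 1, so the error factor is
      at most 2, while \<open>1 / (1 + exp x)\<close> is at most \<open>exp (- x)\<close>.\<close>
    have "norm (f x * (1 - (- exp (- x)) ^ N)) \<le> 2 * g 0 x" for N x
    proof (cases "x > 0")
      case True
      have "norm ((- exp (- x)) ^ N) \<le> 1"
        unfolding norm_power using True by (intro power_le_one) auto
      then have A: "\<bar>1 - (- exp (- x)) ^ N\<bar> \<le> 2"
        unfolding real_norm_def by linarith
      have "1 / (1 + exp x) \<le> 1 / exp x"
        by (intro divide_left_mono mult_pos_pos) (auto simp: add_pos_pos)
      then have "x powr (\<sigma> - 1) * (1 / (1 + exp x)) \<le> x powr (\<sigma> - 1) * (1 / exp x)"
        by (intro mult_left_mono) auto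
      then have "\<bar>f x\<bar> \<le> g 0 x"
        using True by (simp add: f_def g_def exp_minus divide_inverse abs_mult add_pos_pos)
      then have "\<bar>f x\<bar> * \<bar>1 - (- exp (- x)) ^ N\<bar> \<le> g 0 x * 2"
        using A by (intro mult_mono) auto
      then show ?thesis by (simp add: abs_mult)
    qed (simp add: f_def g_def)
    then show "AE x in lborel. norm (\<Sum>k<N. (-1) ^ k * g k x) \<le> 2 * g 0 x" for N
      unfolding sg by simp
  qed
  also have "(\<lambda>N. integral\<^sup>L lborel (\<lambda>x. \<Sum>k<N. (-1) ^ k * g k x)) =
             (\<lambda>N. \<Sum>k<N. (-1) ^ k * (Gamma \<sigma> / real (Suc k) powr \<sigma>))"
    by (intro ext has_bochner_integral_integral_eq has_bochner_integral_sum
              has_bochner_integral_mult_right g)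
  finally have "(\<lambda>k. (-1) ^ k * (Gamma \<sigma> / real (Suc k) powr \<sigma>)) sums integral\<^sup>L lborel f"
    unfolding sums_def .
  then have "(\<lambda>k. (-1) ^ k * (Gamma \<sigma> / real (Suc k) powr \<sigma>) / Gamma \<sigma>) sums (integral\<^sup>L lborel f / Gamma \<sigma>)"
    by (rule sums_divide)
  then show ?thesis
    using Gamma_real_pos[OF \<sigma>] by (simp add: f_def[abs_def] set_lebesgue_integral_def)
qed

section \<open>The normalizing integral\<close>

text \<open>The function \<open>x powr (s - 1) / (1 + exp x)\<close> tends to 0 at both ends of the
  half-line, so its derivative integrates to 0. At the end 0 this relies on \<open>s > 1\<close>, as
  does the integrability of \<open>x powr (s - 2)\<close> there.\<close>

lemma logistic_integral_by_parts:
  fixes s :: real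
  assumes s: "s > 1"
  shows "(LBINT x:{0<..}. x powr (s - 1) * (exp (- x) / (1 + exp (- x))\<^sup>2)) =
         (s - 1) * (LBINT x:{0<..}. x powr (s - 2) / (1 + exp x))"
proof -
  define g where "g x = x powr (s - 2) / (1 + exp x)" for x :: real
  define h where "h x = x powr (s - 1) * (exp (- x) / (1 + exp (- x))\<^sup>2)" for x :: real
  have g: "set_integrable lborel {0<..} g"
  proof (rule set_integrable_bound[OF set_integrable_Gamma[of "s - 1"]])
    show "set_borel_measurable lborel {0<..} g"
      unfolding g_def set_borel_measurable_def by measurable
    have "1 / (1 + exp x) \<le> exp (- x)" for x :: real
      by (simp add: exp_minus divide_simps add_pos_pos)
    then have "x powr (s - 2) * (1 / (1 + exp x)) \<le> x powr (s - 2) * exp (- x)" for x :: real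
      by (intro mult_left_mono) auto
    then show "AE x in lborel. x \<in> {0<..} \<longrightarrow> norm (g x) \<le> norm (x powr (s - 1 - 1) * exp (- x))"
      by (intro AE_I2) (auto simp: g_def abs_mult add_pos_pos)
  qed (use s in auto)
  have h: "set_integrable lborel {0<..} h"
  proof (rule set_integrable_bound[OF set_integrable_Gamma[of s]])
    show "set_borel_measurable lborel {0<..} h"
      unfolding h_def set_borel_measurable_def by measurable
    have "exp (- x) / (1 + exp (- x))\<^sup>2 \<le> exp (- x) / 1" for x :: real
      by (intro divide_left_mono one_le_power mult_pos_pos zero_less_power add_pos_pos) auto
    then have "x powr (s - 1) * (exp (- x) / (1 + exp (- x))\<^sup>2) \<le> x powr (s - 1) * exp (- x)" for x :: real
      by (intro mult_left_mono) auto
    then show "AE x in lborel. x \<in> {0<..} \<longrightarrow> norm (h x) \<le> norm (x powr (s - 1) * exp (- x))"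
      by (intro AE_I2) (auto simp: h_def abs_mult)
  qed (use s in auto)
  have "(LBINT x=0..\<infinity>. (s - 1) * g x - h x) = 0 - 0"
  proof (rule interval_integral_FTC_integrable)
    fix x :: real assume "0 < ereal x"
    then have x: "x > 0" by simp
    have pos: "1 + exp x > 0" by (simp add: add_pos_pos)
    \<comment> \<open>Expanding the fraction by \<open>exp (2 * x)\<close> gives the denominator
      that the quotient rule produces.\<close>
    have h': "h x = x powr (s - 1) * exp x / (1 + exp x)\<^sup>2"
      using pos by (simp add: h_def exp_minus field_simps power2_eq_square)
    have "((\<lambda>x. x powr (s - 1)) has_real_derivative (s - 1) * x powr (s - 1 - 1)) (at x)"
      using x by (rule has_real_derivative_powr)
    moreover have "((\<lambda>x. 1 + exp x) has_real_derivative exp x) (at x)"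
      by (auto intro!: derivative_eq_intros)
    ultimately have "((\<lambda>x. x powr (s - 1) / (1 + exp x)) has_real_derivative
        ((s - 1) * x powr (s - 1 - 1) * (1 + exp x) - x powr (s - 1) * exp x) / ((1 + exp x) * (1 + exp x))) (at x)"
      by (rule DERIV_divide) (use pos in simp)
    moreover have "((s - 1) * x powr (s - 1 - 1) * (1 + exp x) - x powr (s - 1) * exp x) / ((1 + exp x) * (1 + exp x))
        = (s - 1) * g x - h x"
      unfolding h' g_def using pos by (simp add: diff_divide_distrib power2_eq_square)
    ultimately have "((\<lambda>x. x powr (s - 1) / (1 + exp x)) has_real_derivative (s - 1) * g x - h x) (at x)"
      by simp
    then show "((\<lambda>x. x powr (s - 1) / (1 + exp x)) has_vector_derivative (s - 1) * g x - h x) (at x)"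
      by (simp add: has_real_derivative_iff_has_vector_derivative)
    have "1 + exp (- x) > 0" by (simp add: add_pos_pos)
    then show "isCont (\<lambda>x. (s - 1) * g x - h x) x"
      unfolding g_def h_def using x pos by (intro continuous_intros) (auto simp: less_imp_neq[symmetric])
  next
    have "set_integrable lborel {0<..} (\<lambda>x. (s - 1) * g x - h x)"
      by (intro set_integral_diff set_integrable_mult_right g h)
    then show "set_integrable lborel (einterval 0 \<infinity>) (\<lambda>x. (s - 1) * g x - h x)"
      by (simp add: zero_ereal_def)
    have "((\<lambda>x. x powr (s - 1) / (1 + exp x)) \<longlongrightarrow> 0) (at_right (0::real))"
      using s by real_asymp
    then show "(((\<lambda>x. x powr (s - 1) / (1 + exp x)) \<circ> real_of_ereal) \<longlongrightarrow> 0) (at_right 0)"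
      by (simp add: ereal_tendsto_simps1 zero_ereal_def)
    have "((\<lambda>x::real. x powr (s - 1) / (1 + exp x)) \<longlongrightarrow> 0) at_top"
      using s by real_asymp
    then show "(((\<lambda>x. x powr (s - 1) / (1 + exp x)) \<circ> real_of_ereal) \<longlongrightarrow> 0) (at_left \<infinity>)"
      by (simp add: ereal_tendsto_simps1)
  qed simp
  then have "(LBINT x:{0<..}. (s - 1) * g x - h x) = 0"
    by (simp add: interval_lebesgue_integral_0_infty)
  then have "(s - 1) * (LBINT x:{0<..}. g x) - (LBINT x:{0<..}. h x) = 0"
    by (subst (asm) set_integral_diff(2)) (use g h in auto)
  then show ?thesis
    by (simp add: g_def h_def)
qed

text \<open>The case \<open>n = 2\<close>: the antiderivative \<open>1 / (1 + exp (- x))\<close>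
  rises from 1/2 at 0 to 1 at infinity. The integrand is nonnegative, so integrability comes with
  the fundamental theorem.\<close>

lemma logistic_integral_1:
  "(LBINT x:{0<..}. exp (- x) / (1 + exp (- x))\<^sup>2) = (1 / 2 :: real)"
proof -
  have "(LBINT x=0..\<infinity>. exp (- x) / (1 + exp (- x))\<^sup>2) = 1 - (1 / 2 :: real)"
  proof (rule interval_integral_FTC_nonneg)
    fix x :: real
    have pos: "1 + exp (- x) > 0" by (simp add: add_pos_pos)
    show "((\<lambda>x. 1 / (1 + exp (- x))) has_real_derivative exp (- x) / (1 + exp (- x))\<^sup>2) (at x)"
      using pos by (auto intro!: derivative_eq_intros simp: power2_eq_square)
    show "isCont (\<lambda>x. exp (- x) / (1 + exp (- x))\<^sup>2) x"
      using pos by (intro continuous_intros) auto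
  next
    have "((\<lambda>x::real. 1 / (1 + exp (- x))) \<longlongrightarrow> 1 / 2) (at_right 0)"
      by real_asymp
    then show "(((\<lambda>x. 1 / (1 + exp (- x))) \<circ> real_of_ereal) \<longlongrightarrow> 1 / 2) (at_right 0)"
      by (simp add: ereal_tendsto_simps1 zero_ereal_def)
    have "((\<lambda>x::real. 1 / (1 + exp (- x))) \<longlongrightarrow> 1) at_top"
      by real_asymp
    then show "(((\<lambda>x. 1 / (1 + exp (- x))) \<circ> real_of_ereal) \<longlongrightarrow> 1) (at_left \<infinity>)"
      by (simp add: ereal_tendsto_simps1)
  qed auto
  then show ?thesis
    by (simp add: interval_lebesgue_integral_0_infty)
qed

text \<open>The factor \<open>s - 1\<close> from integration by parts cancels against
  \<open>Gamma s = (s - 1) * Gamma (s - 1)\<close>, which leaves the eta value at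
  \<open>s - 1\<close>. This is the common source of the cases \<open>n = 4\<close> and
  \<open>n \<noteq> 4\<close>.\<close>

lemma logistic_const_eta_sums:
  assumes n: "n \<ge> 3"
  shows "\<exists>\<eta>. (\<lambda>k. (-1) ^ k / real (Suc k) powr (real n / 2 - 1)) sums \<eta> \<and>
             logistic_const n = inverse ((2 * pi) powr (real n / 2) * \<eta>)"
proof -
  define s where "s = real n / 2"
  define J where "J = (LBINT x:{0<..}. x powr (s - 2) / (1 + exp x))"
  have s: "s > 1" using n by (simp add: s_def)
  have "Gamma s = (s - 1) * Gamma (s - 1)"
    using Gamma_plus1[of "s - 1"] s by (force elim!: nonpos_Ints_cases')
  moreover have "Gamma (s - 1) > 0" using s by (intro Gamma_real_pos) auto
  ultimately have "logistic_const n = inverse ((2 * pi) powr s * (J / Gamma (s - 1)))"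
    using s unfolding logistic_const_def s_def[symmetric] logistic_integral_by_parts[OF s] J_def[symmetric]
    by (simp add: divide_inverse mult_ac)
  moreover have "(\<lambda>k. (-1) ^ k / real (Suc k) powr (s - 1)) sums (J / Gamma (s - 1))"
    unfolding J_def using eta_sums[of "s - 1"] s by simp
  ultimately show ?thesis
    unfolding s_def by blast
qed

section \<open>From the alternating series to the zeta function\<close>

text \<open>Subtracting twice the terms with even denominator base from the zeta series flips their
  signs; those terms form a scaled copy of the zeta series itself.\<close>

lemma eta_zeta_sums:
  fixes \<sigma> :: real
  assumes \<sigma>: "\<sigma> > 1" and \<eta>: "(\<lambda>k. (-1) ^ k / real (Suc k) powr \<sigma>) sums \<eta>"
  shows "\<exists>Z. (\<lambda>k. 1 / real (Suc k) powr \<sigma>) sums Z \<and> \<eta> = (1 - 2 powr (1 - \<sigma>)) * Z"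
proof -
  define a where "a k = 1 / real (Suc k) powr \<sigma>" for k
  have "summable (\<lambda>k. real k powr - \<sigma>)"
    using \<sigma> by (simp add: summable_real_powr_iff)
  then have "summable a"
    unfolding a_def by (subst (asm) summable_Suc_iff[symmetric]) (simp add: powr_minus divide_inverse)
  then have Z: "a sums suminf a" by (rule summable_sums)
  \<comment> \<open>Index \<open>k\<close> stands for the integer \<open>k + 1\<close>, so odd
    indices carry the even integers.\<close>
  define b where "b k = (if odd k then 2 * a k else 0)" for k
  have "(\<lambda>k. b (2 * k + 1)) sums (2 powr (1 - \<sigma>) * suminf a)"
  proof -
    have "b (2 * k + 1) = 2 powr (1 - \<sigma>) * a k" for k
    proof -
      have "real (Suc (2 * k + 1)) = 2 * real (Suc k)" by simp
      then show ?thesis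
        unfolding b_def a_def by (simp only: powr_mult) (simp add: powr_diff)
    qed
    then show ?thesis using sums_mult[OF Z, of "2 powr (1 - \<sigma>)"] by simp
  qed
  \<comment> \<open>\<open>b\<close> vanishes off the range of \<open>k \<mapsto> 2 * k + 1\<close>,
    so interleaving zeros keeps the sum.\<close>
  then have "b sums (2 powr (1 - \<sigma>) * suminf a)"
    by (subst (asm) sums_mono_reindex)
       (auto simp: strict_mono_def b_def image_iff elim!: oddE)
  from sums_diff[OF Z this]
  have "(\<lambda>k. a k - b k) sums (suminf a - 2 powr (1 - \<sigma>) * suminf a)" .
  also have "(\<lambda>k. a k - b k) = (\<lambda>k. (-1) ^ k / real (Suc k) powr \<sigma>)"
    by (auto simp: fun_eq_iff a_def b_def)
  finally have "\<eta> = suminf a - 2 powr (1 - \<sigma>) * suminf a"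
    using \<eta> sums_unique2 by blast
  then show ?thesis
    using Z by (intro exI[of _ "suminf a"]) (simp add: a_def[abs_def] algebra_simps)
qed

lemma of_nat_Suc_powr_complex_of_real:
  "of_nat (Suc k) powr complex_of_real \<sigma> = complex_of_real (real (Suc k) powr \<sigma>)"
  using powr_of_real[of "real (Suc k)" \<sigma>] by simp

text \<open>Both branches of \<open>riemann_zeta\<close> agree with one expression in the eta value:
  for \<open>\<sigma> > 1\<close> by \<open>eta_zeta_sums\<close>, otherwise by definition. Powers
  of positive reals carry over to the complex principal values.\<close>

lemma riemann_zeta_of_real:
  fixes \<sigma> :: real
  assumes \<sigma>: "\<sigma> \<noteq> 1" and \<eta>: "(\<lambda>k. (-1) ^ k / real (Suc k) powr \<sigma>) sums \<eta>"
  shows "riemann_zeta (complex_of_real \<sigma>) = complex_of_real (\<eta> / (1 - 2 powr (1 - \<sigma>)))"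
proof (cases "\<sigma> > 1")
  case True
  from eta_zeta_sums[OF True \<eta>] obtain Z
    where Z: "(\<lambda>k. 1 / real (Suc k) powr \<sigma>) sums Z" and e: "\<eta> = (1 - 2 powr (1 - \<sigma>)) * Z" by blast
  have "2 powr (1 - \<sigma>) < 2 powr 0" using True by (intro powr_less_mono) auto
  then have "1 - 2 powr (1 - \<sigma>) \<noteq> 0" using True by simp
  then have "Z = \<eta> / (1 - 2 powr (1 - \<sigma>))" unfolding e by (rule nonzero_mult_div_cancel_left[symmetric])
  moreover have "(\<lambda>k. 1 / of_nat (Suc k) powr complex_of_real \<sigma>) sums complex_of_real Z"
    using sums_of_real[OF Z, where 'a = complex]
    unfolding of_nat_Suc_powr_complex_of_real by simp
  ultimately show ?thesis
    using True by (simp add: riemann_zeta_def sums_iff del: of_nat_Suc)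
next
  case False
  have "(\<lambda>k. (-1) ^ k / of_nat (Suc k) powr complex_of_real \<sigma>) sums complex_of_real \<eta>"
    using sums_of_real[OF \<eta>, where 'a = complex]
    unfolding of_nat_Suc_powr_complex_of_real by simp
  moreover have "(2::complex) powr (1 - complex_of_real \<sigma>) = complex_of_real (2 powr (1 - \<sigma>))"
    using powr_of_real[of 2 "1 - \<sigma>"] by simp
  ultimately show ?thesis
    using False by (simp add: riemann_zeta_def sums_iff del: of_nat_Suc)
qed

section \<open>The Hurwitz-Lerch value for \<open>n = 1\<close>\<close>

text \<open>The quotient \<open>Gamma (k + 2) / fact k\<close> is \<open>k + 1\<close>, and dividing
  by \<open>(k + 1) powr (1/2)\<close> leaves a square root.\<close>

lemma hurwitz_lerch_term_2: "hurwitz_lerch_term 2 (-1) (1/2) 1 k = (-1) ^ k * complex_of_real (sqrt (real (Suc k)))"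
proof -
  have "Gamma (2 + of_nat k :: complex) = fact (Suc k)"
    using Gamma_fact[of "Suc k", where 'a = complex] by (simp add: add_ac)
  moreover have "(of_nat k + 1 :: complex) powr (1/2) = complex_of_real (sqrt (real (Suc k)))"
    using of_nat_Suc_powr_complex_of_real[of k "1/2"] by (simp add: powr_half_sqrt add_ac)
  moreover have "real (Suc k) / sqrt (real (Suc k)) = sqrt (real (Suc k))"
    by (rule real_div_sqrt) simp
  then have "complex_of_nat (Suc k) / complex_of_real (sqrt (real (Suc k))) = complex_of_real (sqrt (real (Suc k)))"
    by (metis of_real_divide of_real_of_nat_eq)
  moreover have "complex_of_nat (Suc k) = of_nat k + 1" by simp
  moreover have "(fact (Suc k) :: complex) / fact k = of_nat (Suc k)" by simp
  ultimately show ?thesis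
    unfolding hurwitz_lerch_term_def by (metis times_divide_eq_left times_divide_eq_right mult.commute)
qed

text \<open>The terms grow in modulus, so the series diverges and the definition takes its integral
  branch, whose integrand at these arguments is the real logistic one.\<close>

lemma hurwitz_lerch_zeta_half:
  "hurwitz_lerch_zeta 2 (-1) (1/2) 1 = complex_of_real
     ((LBINT x:{0<..}. x powr (- 1 / 2) * (exp (- x) / (1 + exp (- x))\<^sup>2)) / Gamma (1 / 2))"
proof -
  have "\<not> hurwitz_lerch_term 2 (-1) (1/2) 1 \<longlonglongrightarrow> 0"
  proof
    assume "hurwitz_lerch_term 2 (-1) (1/2) 1 \<longlonglongrightarrow> 0"
    then have "(\<lambda>k. norm (hurwitz_lerch_term 2 (-1) (1/2) 1 k)) \<longlonglongrightarrow> 0"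
      by (rule tendsto_norm_zero)
    then have "(\<lambda>k. sqrt (real (Suc k))) \<longlonglongrightarrow> 0"
      by (simp add: hurwitz_lerch_term_2 norm_mult norm_power)
    moreover have "filterlim (\<lambda>k. sqrt (real (Suc k))) at_top sequentially" by real_asymp
    ultimately show False
      using not_tendsto_and_filterlim_at_infinity[of sequentially]
        filterlim_at_top_imp_at_infinity trivial_limit_sequentially by blast
  qed
  then have "\<not> summable (hurwitz_lerch_term 2 (-1) (1/2) 1)"
    using summable_LIMSEQ_zero by blast
  moreover have "complex_of_real t powr (1/2 - 1) * exp (- 1 * complex_of_real t) /
                   (1 - (-1) * exp (- complex_of_real t)) powr 2 =
                 complex_of_real (t powr (- 1 / 2) * (exp (- t) / (1 + exp (- t))\<^sup>2))" if "t > 0" for t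
  proof -
    have "complex_of_real t powr (1/2 - 1) = complex_of_real (t powr (- 1 / 2))"
      using powr_of_real[of t "- 1 / 2"] that by simp
    moreover have "(1 - (-1) * exp (- complex_of_real t)) = complex_of_real (1 + exp (- t))"
      by (simp flip: exp_of_real)
    moreover have "complex_of_real (1 + exp (- t)) powr 2 = complex_of_real ((1 + exp (- t))\<^sup>2)"
      using powr_of_real[of "1 + exp (- t)" 2] by (simp add: powr_numeral add_nonneg_nonneg)
    ultimately show ?thesis by (simp flip: exp_of_real)
  qed
  then have "(LBINT t:{0<..}. complex_of_real t powr (1/2 - 1) * exp (- 1 * complex_of_real t) /
                   (1 - (-1) * exp (- complex_of_real t)) powr 2) =
      (LBINT t:{0<..}. complex_of_real (t powr (- 1 / 2) * (exp (- t) / (1 + exp (- t))\<^sup>2)))"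
    by (intro set_lebesgue_integral_cong) auto
  moreover have "Gamma (1 / 2 :: complex) = complex_of_real (Gamma (1 / 2))"
    using Gamma_complex_of_real[of "1/2"] by simp
  ultimately show ?thesis
    unfolding hurwitz_lerch_zeta_def by (simp only: set_integral_complex_of_real) simp
qed

theorem corollary2p1:
  shows "complex_of_real (logistic_const 1) =
           1 / complex_of_real (sqrt (2 * pi)) * inverse (hurwitz_lerch_zeta 2 (-1) (1/2) 1)
       \<and> logistic_const 2 = inverse pi
       \<and> logistic_const 4 = 1 / (4 * pi\<^sup>2 * ln 2)
       \<and> (\<forall>n::nat. n \<ge> 3 \<and> n \<noteq> 4 \<longrightarrow>
            complex_of_real (logistic_const n) =
              complex_of_real (pi powr (- (real n / 2))) *
              inverse (complex_of_real (2 powr (real n / 2) - 4) *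
                       riemann_zeta (complex_of_real (real n / 2 - 1))))"
proof (intro conjI allI impI)
  show "complex_of_real (logistic_const 1) =
           1 / complex_of_real (sqrt (2 * pi)) * inverse (hurwitz_lerch_zeta 2 (-1) (1/2) 1)"
    unfolding hurwitz_lerch_zeta_half logistic_const_def
    by (simp add: powr_half_sqrt field_simps)
next
  \<comment> \<open>The exponent is 0, and \<open>x powr 0 = 1\<close> fails at
    \<open>x = 0\<close>; hence the congruence on the open half-line.\<close>
  have "(LBINT x:{0<..}. x powr (real 2 / 2 - 1) * (exp (- x) / (1 + exp (- x))\<^sup>2)) =
        (LBINT x:{0<..}. exp (- x) / (1 + exp (- x))\<^sup>2)"
    by (intro set_lebesgue_integral_cong) auto
  then show "logistic_const 2 = inverse pi"
    unfolding logistic_const_def logistic_integral_1 by (simp add: field_simps)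
next
  from logistic_const_eta_sums[of 4] obtain \<eta>
    where \<eta>: "(\<lambda>k. (-1) ^ k / real (Suc k) powr 1) sums \<eta>"
      and c: "logistic_const 4 = inverse ((2 * pi) powr 2 * \<eta>)" by auto
  have "\<eta> = ln 2"
    using \<eta> sums_unique2[OF _ alternating_harmonic_series_sums] by simp
  with c show "logistic_const 4 = 1 / (4 * pi\<^sup>2 * ln 2)"
    by (simp add: powr_numeral power2_eq_square field_simps)
next
  fix n :: nat
  assume n: "n \<ge> 3 \<and> n \<noteq> 4"
  define s where "s = real n / 2"
  \<comment> \<open>Excluding \<open>n = 4\<close> keeps \<open>s - 1\<close> away from the pole of
    zeta at 1.\<close>
  have "s \<noteq> 2" using n by (simp add: s_def)
  from logistic_const_eta_sums[of n] n obtain \<eta>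
    where \<eta>: "(\<lambda>k. (-1) ^ k / real (Suc k) powr (s - 1)) sums \<eta>"
      and c: "logistic_const n = inverse ((2 * pi) powr s * \<eta>)" by (auto simp: s_def)
  have zeta: "riemann_zeta (complex_of_real (s - 1)) = complex_of_real (\<eta> / (1 - 2 powr (2 - s)))"
    using riemann_zeta_of_real[OF _ \<eta>] \<open>s \<noteq> 2\<close> by (simp add: algebra_simps)
  have "2 powr (2 - s) \<noteq> 2 powr (0::real)"
    using \<open>s \<noteq> 2\<close> powr_inj[of "2::real" "2 - s" 0] by simp
  then have ne: "1 - 2 powr (2 - s) \<noteq> 0" by simp
  \<comment> \<open>The prefactor cancels the denominator of the zeta formula; the remaining
    \<open>2 powr s\<close> joins \<open>pi powr s\<close> to form
    \<open>(2 * pi) powr s\<close>.\<close>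
  have "2 powr s - 4 = 2 powr s * (1 - 2 powr (2 - s))"
    by (simp add: powr_diff field_simps)
  with ne have "(2 powr s - 4) * (\<eta> / (1 - 2 powr (2 - s))) = 2 powr s * \<eta>" by simp
  then have "logistic_const n = pi powr (- s) * inverse ((2 powr s - 4) * (\<eta> / (1 - 2 powr (2 - s))))"
    using c by (simp add: powr_mult powr_minus)
  then show "complex_of_real (logistic_const n) =
              complex_of_real (pi powr (- (real n / 2))) *
              inverse (complex_of_real (2 powr (real n / 2) - 4) *
                       riemann_zeta (complex_of_real (real n / 2 - 1)))"
    unfolding s_def[symmetric] zeta by (simp only: of_real_mult of_real_inverse)
qed

end
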